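(* Let $\{[\mathbb{X}^s]\}_{s\in[S]}$ be classes (under weak isomorphism) of finite networks, and let $[\mathbb{Y}]$ be a class of finite networks. Let $(\mathbf{Y}_b,\mathrm{q}_b)$, $\mathbf{X}^1_b,\dots,\mathbf{X}^S_b$ be an optimal blow-up of the templates with respect to $\mathbb{Y}$, and let $\mathcal{A}\in\mathbb{R}^{S\times S}$ be the matrix $$\mathcal{A}_{sr}:=\mathrm{tr}_{\mathrm{q}_b}\big((\mathbf{X}^s_b-\mathbf{Y}_b)^T(\mathbf{X}^r_b-\mathbf{Y}_b)\big),\qquad s,r\in[S].$$ Then $[\mathbb{Y}]\in\widetilde{\mathrm{Bary}}(\{[\mathbb{X}^s]\}_{s\in[S]})$ if and only if $$\min_{\lambda\in\Delta_{S-1}}\lambda^T\mathcal{A}\lambda=0,$$ and in that case a solution argument $\lambda_{\mathbb{Y}}\in\Delta_{S-1}$ of this minimization is a weight vector corresponding to $[\mathbb{Y}]$ as a weak GW barycenter, i.e. $\nabla G_{\lambda_{\mathbb{Y}}}([\mathbb{Y}])=0$. Equivalently (in that case), $\lambda_{\mathbb{Y}}$ solves the linear problem $$L\lambda=c\quad\text{subject to }\lambda\in\Delta_{S-1}\subset\mathbb{R}^S,$$ where $L\in\mathbb{R}^{S\times S}$ and $c\in\mathbb{R}^S$ are given by $$L_{sr}:=\mathrm{tr}_{\mathrm{q}_b}\big((\mathbf{X}^s_b)^T\mathbf{X}^r_b\big)\quad\forall s,r\in[S],\qquad c_s:=\mathrm{tr}_{\mathrm{q}_b}\big(\mathbf{Y}_b^T\mathbf{X}^s_b\big)\quad\forall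 s\in[S].$$
   Context: Notation: $[S]=\{1,\dots,S\}$; $\Delta_{S-1}=\{\lambda\in\mathbb{R}^S:\lambda_s\ge0,\sum_s\lambda_s=1\}$; $\mathcal{P}_N$ is the set of probability vectors in $\mathbb{R}^N$ with strictly positive entries. A finite network with $N$ nodes is a pair $(\mathbf{X},\mathrm{p})\in\mathbb{R}^{N\times N}\times\mathcal{P}_N$ (weights $\omega_X(x_i,x_j)=\mathbf{X}_{ij}$ on a node set $X=\{x_i\}$, measure $\mu_X=\sum_i\mathrm{p}_i\delta_{x_i}$). With $\Pi(\mathrm{p},\mathrm{q})$ the set of nonnegative matrices with row sums $\mathrm{p}$ and column sums $\mathrm{q}$, $$GW((\mathbf{X},\mathrm{p}),(\mathbf{Y},\mathrm{q}))^2=\min_{\pi\in\Pi(\mathrm{p},\mathrm{q})}\sum_{i,k}\sum_{j,l}|\mathbf{X}_{ik}-\mathbf{Y}_{jl}|^2\pi_{ij}\pi_{kl},$$ and a minimizer is an optimal coupling. Two networks $\mathbb{X},\mathbb{Y}$ are weakly isomorphic ($\mathbb{X}\sim^w\mathbb{Y}$) if there are a Borel probability space $(Z,\mu_Z)$ and measurable $\varphi_X:Z\to X$, $\varphi_Y:Z\to Y$ with $(\varphi_X)_\#\mu_Z=\mu_X$, $(\varphi_Y)_\#\mu_Z=\mu_Y$ and $\omega_X(\varphi_X(z),\varphi_X(z'))=\omega_Y(\varphi_Y(z),\varphi_Y(z'))$ a.e.; equivalently $GW(\mathbb{X},\mathbb{Y})=0$. $[\mathbb{Y}]$ is the class of $\mathbb{Y}$.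 Weighted trace: for $\mathrm{q}\in\mathcal{P}_M$ and $A,B\in\mathbb{R}^{M\times M}$, $\mathrm{tr}_{\mathrm{q}}(A^TB):=\sum_{i,j\in[M]}A_{ij}B_{ij}\mathrm{q}_i\mathrm{q}_j$. Optimal blow-up of templates $(\mathbf{X}^s,\mathrm{p}^s)$, $s\in[S]$, with respect to $(\mathbf{Y},\mathrm{q})$: start with the current network $(\mathbf{Y},\mathrm{q})$. For $s=1,\dots,S$ successively: choose an optimal coupling $\pi$ for $GW((\mathbf{X}^s,\mathrm{p}^s),(\mathbf{Y},\mathrm{q}))$ with the current $(\mathbf{Y},\mathrm{q})$; enumerate its nonzero entries as $(a_l,b_l)$, $l=1,\dots,m$; define $\mathbf{X}^s_b[l,l']:=\mathbf{X}^s[a_l,a_{l'}]$; for every $r<s$ replace $\mathbf{X}^r_b$ by the matrix with entries $\mathbf{X}^r_b[b_l,b_{l'}]$; replace $\mathbf{Y}$ by the matrix with entries $\mathbf{Y}[b_l,b_{l'}]$; replace $\mathrm{q}$ by the vector with entries $\pi[a_l,b_l]$. After step $S$ call the resulting size $M_b$ and the current network $(\mathbf{Y}_b,\mathrm{q}_b)$; all $\mathbf{X}^s_b$ and $\mathbf{Y}_b$ are $M_b\times M_b$. Barycenter functional and gradient: for $\lambda\in\Delta_{S-1}$, $G_\lambda([\mathbb{Y}]):=\frac12\sum_{s\in[S]}\lambda_sGW^2(\mathbb{X}^s,\mathbb{Y})$. The tangent space at $[\mathbb{Y}]$ consists of classes of functions (matrices) in $L^2(Y'\times Y',\mu_{Y'}\otimes\mu_{Y'})$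 over representatives $\mathbb{Y}'$ of $[\mathbb{Y}]$; on the representative $(\mathbf{Y}_b,\mathrm{q}_b)$ the inner product is $(A,B)\mapsto\mathrm{tr}_{\mathrm{q}_b}(A^TB)$. The gradient $\nabla G_\lambda([\mathbb{Y}])$ is the Riesz representative of the directional derivatives of $G_\lambda$, and it is identified (a recalled result of Chowdhury and Needham), after the optimal blow-up with respect to $\mathbb{Y}$, with the tangent vector represented by the matrix $\sum_{s\in[S]}\lambda_s\mathbf{X}^s_b-\mathbf{Y}_b\in\mathbb{R}^{M_b\times M_b}$; this is the meaning of $\nabla G_\lambda([\mathbb{Y}])$ here. The weak GW barycenter space is $\widetilde{\mathrm{Bary}}(\{[\mathbb{X}^s]\}_{s\in[S]}):=\{[\mathbb{Y}_\lambda]:\nabla G_\lambda([\mathbb{Y}_\lambda])=0\text{ for some }\lambda\in\Delta_{S-1}\}$. *)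

theory Defs
  imports "HOL-Probability.Probability" "Jordan_Normal_Form.Matrix"
begin

unbundle no vec_syntax
unbundle no inner_syntax

type_synonym network = "real mat \<times> real vec"

text \<open>Index sets \<open>[n]\<close> are rendered as \<open>{0..<n}\<close>, following the conventions of the matrix
  library.\<close>

definition finite_network :: "network \<Rightarrow> bool" where
  "finite_network P \<longleftrightarrow> (case P of (X, p) \<Rightarrow>
     X \<in> carrier_mat (dim_vec p) (dim_vec p) \<and>
     (\<forall>i<dim_vec p. 0 < p $ i) \<and> (\<Sum>i<dim_vec p. p $ i) = 1)"

definition network_measure :: "network \<Rightarrow> nat measure" where
  "network_measure P = point_measure {..<dim_vec (snd P)} (\<lambda>i. ennreal (snd P $ i))"

text \<open>The Borel probability space in the definition of weak isomorphism lives on the real line: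
  HOL cannot quantify over types, and every standard Borel space is Borel isomorphic to a Borel
  subset of the reals.\<close>

definition weak_iso :: "(network \<times> network) set" where
  "weak_iso = {(P, Q). finite_network P \<and> finite_network Q \<and>
     (\<exists>(\<mu> :: real measure) \<phi> \<psi>. prob_space \<mu> \<and> sets \<mu> = sets borel \<and>
        \<phi> \<in> measurable \<mu> (network_measure P) \<and> \<psi> \<in> measurable \<mu> (network_measure Q) \<and>
        distr \<mu> (network_measure P) \<phi> = network_measure P \<and>
        distr \<mu> (network_measure Q) \<psi> = network_measure Q \<and>
        (AE z in \<mu> \<Otimes>\<^sub>M \<mu>. fst P $$ (\<phi> (fst z), \<phi> (snd z)) = fst Q $$ (\<psi> (fst z), \<psi> (snd z))))}"

definition net_class :: "network \<Rightarrow> network set" where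
  "net_class P = weak_iso `` {P}"

definition net_classes :: "network set set" where
  "net_classes = {P. finite_network P} // weak_iso"

definition couplings :: "real vec \<Rightarrow> real vec \<Rightarrow> real mat set" where
  "couplings p q = {\<pi> \<in> carrier_mat (dim_vec p) (dim_vec q).
     (\<forall>i<dim_vec p. \<forall>j<dim_vec q. 0 \<le> \<pi> $$ (i, j)) \<and>
     (\<forall>i<dim_vec p. (\<Sum>j<dim_vec q. \<pi> $$ (i, j)) = p $ i) \<and>
     (\<forall>j<dim_vec q. (\<Sum>i<dim_vec p. \<pi> $$ (i, j)) = q $ j)}"

definition gw_cost :: "network \<Rightarrow> network \<Rightarrow> real mat \<Rightarrow> real" where
  "gw_cost P Q \<pi> =
     (\<Sum>i<dim_vec (snd P). \<Sum>k<dim_vec (snd P). \<Sum>j<dim_vec (snd Q). \<Sum>l<dim_vec (snd Q).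
        \<bar>fst P $$ (i, k) - fst Q $$ (j, l)\<bar>\<^sup>2 * \<pi> $$ (i, j) * \<pi> $$ (k, l))"

definition optimal_coupling :: "network \<Rightarrow> network \<Rightarrow> real mat \<Rightarrow> bool" where
  "optimal_coupling P Q = is_arg_min (gw_cost P Q) (\<lambda>\<pi>. \<pi> \<in> couplings (snd P) (snd Q))"

definition wtrace :: "real vec \<Rightarrow> real mat \<Rightarrow> real mat \<Rightarrow> real" where
  \<comment> \<open>\<open>wtrace q A B\<close> is the weighted trace of \<open>A\<^sup>T B\<close>\<close>
  "wtrace q A B = (\<Sum>i<dim_vec q. \<Sum>j<dim_vec q. A $$ (i, j) * B $$ (i, j) * q $ i * q $ j)"

definition reindex :: "nat list \<Rightarrow> real mat \<Rightarrow> real mat" where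
  "reindex ks A = mat (length ks) (length ks) (\<lambda>(l, l'). A $$ (ks ! l, ks ! l'))"

text \<open>A blow-up is given by the matrices \<open>X\<^sub>b\<close> of the templates processed so far together with the
  current network \<open>(Y\<^sub>b, q\<^sub>b)\<close>. The blow-up is a relation since it depends on the chosen optimal
  couplings and on the enumerations (the lists \<open>es\<close>) of their supports.\<close>

type_synonym blowup = "real mat list \<times> network"

inductive optimal_blowup :: "(nat \<Rightarrow> network) \<Rightarrow> network \<Rightarrow> nat \<Rightarrow> blowup \<Rightarrow> bool"
  for Xs :: "nat \<Rightarrow> network" and Y :: network where
  start: "optimal_blowup Xs Y 0 ([], Y)"
| step: "optimal_blowup Xs Y s (Xb, (Yc, qc)) \<Longrightarrow>
    optimal_coupling (Xs s) (Yc, qc) \<pi> \<Longrightarrow>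
    distinct es \<Longrightarrow>
    set es = {(a, b). a < dim_row \<pi> \<and> b < dim_col \<pi> \<and> \<pi> $$ (a, b) \<noteq> 0} \<Longrightarrow>
    optimal_blowup Xs Y (Suc s)
      (map (reindex (map snd es)) Xb @ [reindex (map fst es) (fst (Xs s))],
       (reindex (map snd es) Yc, vec (length es) (\<lambda>l. \<pi> $$ (es ! l))))"

definition prob_simplex :: "nat \<Rightarrow> real vec set" where
  "prob_simplex S = {w \<in> carrier_vec S. (\<forall>s<S. 0 \<le> w $ s) \<and> (\<Sum>s<S. w $ s) = 1}"

text \<open>The matrix representing the gradient at \<open>[Y]\<close> of the barycenter functional
  \<open>[Y] \<mapsto> 1/2 \<Sum>\<^sub>s w\<^sub>s GW\<^sup>2(X\<^sup>s, Y)\<close> depends on the optimal blow-up, and so does whether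
  it vanishes: for \<open>Y = ((0,1),(1,0))\<close> with uniform weights and \<open>E = ((e,0),(0,0))\<close> with
  small \<open>e > 0\<close>, both the identity and the swap are optimal couplings of \<open>Y + E\<close>, as of
  \<open>Y - E\<close>, with \<open>Y\<close>; the choice (identity, identity) gives a vanishing gradient for
  \<open>w = (1/2, 1/2)\<close>, while (identity, swap) does not for any \<open>w\<close>. The gradient, as a function
  on classes, is therefore taken relative to a rule \<open>\<beta>\<close> which assigns to every class an optimal
  blow-up of representatives of the template classes \<open>\<X> s\<close> with respect to one of its
  representatives.\<close>

definition blowup_rule :: "nat \<Rightarrow> (nat \<Rightarrow> network set) \<Rightarrow> (network set \<Rightarrow> blowup) \<Rightarrow> bool" where
  "blowup_rule S \<X> \<beta> \<longleftrightarrow> (\<forall>C\<in>net_classes. \<exists>Xs Y.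
     (\<forall>s<S. Xs s \<in> \<X> s) \<and> Y \<in> C \<and> optimal_blowup Xs Y S (\<beta> C))"

definition gw_gradient :: "(network set \<Rightarrow> blowup) \<Rightarrow> nat \<Rightarrow> real vec \<Rightarrow> network set \<Rightarrow> real mat" where
  "gw_gradient \<beta> S w C = (case \<beta> C of (Xb, (Yb, qb)) \<Rightarrow>
     mat (dim_vec qb) (dim_vec qb)
       (\<lambda>(i, j). (\<Sum>s<S. w $ s * (Xb ! s) $$ (i, j)) - Yb $$ (i, j)))"

text \<open>The gradient is a tangent vector represented on \<open>(Y\<^sub>b, q\<^sub>b)\<close>, an element of
  \<open>L\<^sup>2(q\<^sub>b \<otimes> q\<^sub>b)\<close>. As \<open>q\<^sub>b\<close> has strictly positive entries, it vanishes iff the matrix is zero.\<close>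

definition gw_gradient_vanishes ::
  "(network set \<Rightarrow> blowup) \<Rightarrow> nat \<Rightarrow> real vec \<Rightarrow> network set \<Rightarrow> bool" where
  "gw_gradient_vanishes \<beta> S w C \<longleftrightarrow>
     gw_gradient \<beta> S w C = 0\<^sub>m (dim_vec (snd (snd (\<beta> C)))) (dim_vec (snd (snd (\<beta> C))))"

definition weak_bary :: "(network set \<Rightarrow> blowup) \<Rightarrow> nat \<Rightarrow> network set set" where
  "weak_bary \<beta> S = {C \<in> net_classes. \<exists>w\<in>prob_simplex S. gw_gradient_vanishes \<beta> S w C}"

end

theory Submission
  imports Defs
begin

text \<open>For \<open>w\<close> in the simplex the gradient is \<open>D = \<Sum>\<^sub>s w\<^sub>s (X\<^sup>s\<^sub>b - Y\<^sub>b)\<close>, and \<open>w\<^sup>T \<A> w\<close> is its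
  squared norm, which is positive definite because \<open>q\<^sub>b\<close> has strictly positive entries. If some
  \<open>w\<^sub>0\<close> in the simplex has vanishing gradient, then \<open>L w\<^sub>0 = c\<close>; any other solution \<open>w\<close> satisfies
  \<open>L (w - w\<^sub>0) = 0\<close>, and as \<open>L\<close> is a Gram matrix, \<open>\<Sum>\<^sub>s w\<^sub>s X\<^sup>s\<^sub>b = \<Sum>\<^sub>s w\<^sub>0\<^sub>s X\<^sup>s\<^sub>b = Y\<^sub>b\<close>.\<close>

text \<open>The explicit size makes the combination square whatever the dimensions of the
  \<open>M s\<close>; only their entries with indices below \<open>n\<close> enter.\<close>

definition mat_lincomb :: "nat \<Rightarrow> nat \<Rightarrow> (nat \<Rightarrow> real) \<Rightarrow> (nat \<Rightarrow> real mat) \<Rightarrow> real mat" where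
  "mat_lincomb n S u M = mat n n (\<lambda>ij. \<Sum>s<S. u s * M s $$ ij)"

lemma mat_lincomb_carrier [simp]: "mat_lincomb n S u M \<in> carrier_mat n n"
  by (simp add: mat_lincomb_def)

lemma index_mat_lincomb [simp]:
  "i < n \<Longrightarrow> j < n \<Longrightarrow> mat_lincomb n S u M $$ (i, j) = (\<Sum>s<S. u s * M s $$ (i, j))"
  by (simp add: mat_lincomb_def)

lemma wtrace_commute: "wtrace q A B = wtrace q B A"
  by (simp add: wtrace_def mult.commute)

text \<open>Linearity in the second slot. The coefficient stands on the right to match a row of a
  matrix-vector product.\<close>

lemma wtrace_lincomb_right:
  "wtrace q A (mat_lincomb (dim_vec q) S u M) = (\<Sum>r<S. wtrace q A (M r) * u r)"
proof -
  have "wtrace q A (mat_lincomb (dim_vec q) S u M) =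
      (\<Sum>i<dim_vec q. \<Sum>j<dim_vec q. \<Sum>r<S. A $$ (i, j) * M r $$ (i, j) * q $ i * q $ j * u r)"
    unfolding wtrace_def
    by (intro sum.cong refl) (simp add: sum_distrib_left sum_distrib_right mult_ac)
  also have "\<dots> = (\<Sum>i<dim_vec q. \<Sum>r<S. \<Sum>j<dim_vec q. A $$ (i, j) * M r $$ (i, j) * q $ i * q $ j * u r)"
    by (intro sum.cong refl sum.swap)
  also have "\<dots> = (\<Sum>r<S. \<Sum>i<dim_vec q. \<Sum>j<dim_vec q. A $$ (i, j) * M r $$ (i, j) * q $ i * q $ j * u r)"
    by (rule sum.swap)
  finally show ?thesis
    by (simp add: wtrace_def sum_distrib_right)
qed

lemma wtrace_lincomb_lincomb:
  "wtrace q (mat_lincomb (dim_vec q) S u M) (mat_lincomb (dim_vec q) S u M) =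
    (\<Sum>s<S. u s * (\<Sum>r<S. wtrace q (M s) (M r) * u r))"
proof -
  let ?D = "mat_lincomb (dim_vec q) S u M"
  have "wtrace q ?D ?D = (\<Sum>s<S. wtrace q ?D (M s) * u s)"
    by (rule wtrace_lincomb_right)
  \<comment> \<open>Symmetry puts \<open>?D\<close> back into the second slot, so that linearity
    applies once more.\<close>
  also have "\<dots> = (\<Sum>s<S. wtrace q (M s) ?D * u s)"
    by (intro sum.cong refl arg_cong2[of _ _ _ _ "(*)"] wtrace_commute)
  finally show ?thesis
    by (simp add: wtrace_lincomb_right mult.commute)
qed

context
  fixes q :: "real vec"
  assumes q_pos: "\<And>i. i < dim_vec q \<Longrightarrow> 0 < q $ i"
begin

lemma wtrace_self_summand_nonneg:
  assumes "i < dim_vec q" "j < dim_vec q"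
  shows "0 \<le> A $$ (i, j) * A $$ (i, j) * q $ i * q $ j"
  by (intro mult_nonneg_nonneg[OF mult_nonneg_nonneg[OF zero_le_square]] less_imp_le q_pos assms)

lemma wtrace_self_nonneg: "0 \<le> wtrace q A A"
  unfolding wtrace_def by (intro sum_nonneg wtrace_self_summand_nonneg) auto

text \<open>A vanishing sum of nonnegative terms vanishes termwise, and positive weights leave only
  the squared entries. The carrier condition excludes entries that \<open>wtrace\<close> does not
  see.\<close>

lemma wtrace_self_eq_0_iff:
  assumes "A \<in> carrier_mat (dim_vec q) (dim_vec q)"
  shows "wtrace q A A = 0 \<longleftrightarrow> A = 0\<^sub>m (dim_vec q) (dim_vec q)"
proof
  assume "wtrace q A A = 0"
  then have "\<forall>i\<in>{..<dim_vec q}. (\<Sum>j<dim_vec q. A $$ (i, j) * A $$ (i, j) * q $ i * q $ j) = 0"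
    unfolding wtrace_def
    by (subst (asm) sum_nonneg_eq_0_iff) (auto intro!: sum_nonneg wtrace_self_summand_nonneg)
  then have "A $$ (i, j) * A $$ (i, j) * q $ i * q $ j = 0"
    if "i < dim_vec q" "j < dim_vec q" for i j
    using that sum_nonneg_eq_0_iff[of "{..<dim_vec q}" "\<lambda>j. A $$ (i, j) * A $$ (i, j) * q $ i * q $ j"]
      wtrace_self_summand_nonneg[of i]
    by blast
  then have "A $$ (i, j) = 0" if "i < dim_vec q" "j < dim_vec q" for i j
    using that q_pos[of i] q_pos[of j] by fastforce
  then show "A = 0\<^sub>m (dim_vec q) (dim_vec q)"
    using assms by (intro eq_matI) auto
qed (simp add: wtrace_def)

end

text \<open>The last step decides: its weights are the nonzero entries of a coupling, and couplings
  are nonnegative. The assumption on \<open>Y\<close> covers the blow-up with no step.\<close>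

lemma optimal_blowup_current_network:
  assumes "optimal_blowup Xs Y S B" "finite_network Y"
  shows "fst (snd B) \<in> carrier_mat (dim_vec (snd (snd B))) (dim_vec (snd (snd B))) \<and>
    (\<forall>i<dim_vec (snd (snd B)). 0 < snd (snd B) $ i)"
  using assms
proof (cases rule: optimal_blowup.cases)
  case (step s Xb Yc qc \<pi> es)
  have "0 \<le> \<pi> $$ ab" if "ab \<in> set es" for ab
    using that step by (auto simp: optimal_coupling_def is_arg_min_def couplings_def)
  moreover have "\<pi> $$ ab \<noteq> 0" if "ab \<in> set es" for ab
    using that step by auto
  ultimately have "0 < \<pi> $$ ab" if "ab \<in> set es" for ab
    using that by (simp add: order_less_le)
  then show ?thesis
    unfolding step(2) by (simp add: reindex_def)
qed (auto simp: finite_network_def split: prod.splits)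

text \<open>The quadratic form of a Gram matrix is a squared norm. The family \<open>M\<close> is
  arbitrary because the differences from \<open>Yb\<close> give \<open>A\<close> and the templates
  themselves give \<open>L\<close>.\<close>

lemma gram_quadratic_form:
  assumes "w \<in> carrier_vec S"
  shows "w \<bullet> (mat S S (\<lambda>(s, r). wtrace q (M s) (M r)) *\<^sub>v w) =
    wtrace q (mat_lincomb (dim_vec q) S (($) w) M) (mat_lincomb (dim_vec q) S (($) w) M)"
  using assms
  by (simp add: wtrace_lincomb_lincomb scalar_prod_def atLeast0LessThan)

lemma gram_mult_vec:
  assumes "w \<in> carrier_vec S" "s < S"
  shows "(mat S S (\<lambda>(s, r). wtrace q (M s) (M r)) *\<^sub>v w) $ s =
    wtrace q (M s) (mat_lincomb (dim_vec q) S (($) w) M)"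
  using assms
  by (simp add: wtrace_lincomb_right scalar_prod_def atLeast0LessThan)

theorem theorem4p7:
  fixes S :: nat and Xs :: "nat \<Rightarrow> network" and Y :: network
    and Xb :: "real mat list" and Yb :: "real mat" and qb :: "real vec"
    and \<beta> :: "network set \<Rightarrow> blowup"
    and A L :: "real mat" and c :: "real vec"
  assumes templates: "\<And>s. s < S \<Longrightarrow> finite_network (Xs s)"
    and network: "finite_network Y"
    and blowup: "optimal_blowup Xs Y S (Xb, (Yb, qb))"
    and rule: "blowup_rule S (\<lambda>s. net_class (Xs s)) \<beta>"
    and rule_Y: "\<beta> (net_class Y) = (Xb, (Yb, qb))"
    and A_def: "A = mat S S (\<lambda>(s, r). wtrace qb (Xb ! s - Yb) (Xb ! r - Yb))"
    and L_def: "L = mat S S (\<lambda>(s, r). wtrace qb (Xb ! s) (Xb ! r))"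
    and c_def: "c = vec S (\<lambda>s. wtrace qb Yb (Xb ! s))"
  shows "(net_class Y \<in> weak_bary \<beta> S \<longleftrightarrow>
           (\<exists>w. is_arg_min (\<lambda>v. v \<bullet> (A *\<^sub>v v)) (\<lambda>v. v \<in> prob_simplex S) w \<and>
                w \<bullet> (A *\<^sub>v w) = 0)) \<and>
         (net_class Y \<in> weak_bary \<beta> S \<longrightarrow>
           (\<forall>w. is_arg_min (\<lambda>v. v \<bullet> (A *\<^sub>v v)) (\<lambda>v. v \<in> prob_simplex S) w \<longrightarrow>
                gw_gradient_vanishes \<beta> S w (net_class Y)) \<and>
           (\<forall>w. is_arg_min (\<lambda>v. v \<bullet> (A *\<^sub>v v)) (\<lambda>v. v \<in> prob_simplex S) w \<longleftrightarrow>
                w \<in> prob_simplex S \<and> L *\<^sub>v w = c))"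
proof -
  define n where "n = dim_vec qb"
  define P where "P = (\<lambda>w. mat_lincomb n S (($) w) ((!) Xb))"
  define D where "D = (\<lambda>w. mat_lincomb n S (($) w) (\<lambda>s. Xb ! s - Yb))"
  let ?Q = "\<lambda>v. v \<bullet> (A *\<^sub>v v)"
  let ?argmin = "is_arg_min ?Q (\<lambda>v. v \<in> prob_simplex S)"
  have Yb: "Yb \<in> carrier_mat n n" and q_pos: "\<And>i. i < dim_vec qb \<Longrightarrow> 0 < qb $ i"
    using optimal_blowup_current_network[OF blowup network] by (auto simp: n_def)
  have carrier: "w \<in> carrier_vec S" if "w \<in> prob_simplex S" for w
    using that by (simp add: prob_simplex_def)
  have Q: "?Q w = wtrace qb (D w) (D w)" if "w \<in> prob_simplex S" for w
    using gram_quadratic_form[OF carrier[OF that], of qb "\<lambda>s. Xb ! s - Yb"]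
    by (simp add: A_def D_def n_def)
  have Q_nonneg: "0 \<le> ?Q w" if "w \<in> prob_simplex S" for w
    using wtrace_self_nonneg[of qb "D w", OF q_pos] Q[OF that] by simp
  \<comment> \<open>The weights sum to 1, so the subtracted copies of \<open>Yb\<close> add up to
    exactly one.\<close>
  have D_eq: "D w = P w - Yb" if "w \<in> prob_simplex S" for w
  proof (rule eq_matI)
    fix i j assume ij: "i < dim_row (P w - Yb)" "j < dim_col (P w - Yb)"
    have "(\<Sum>s<S. w $ s * (Xb ! s $$ (i, j) - Yb $$ (i, j))) =
        (\<Sum>s<S. w $ s * Xb ! s $$ (i, j)) - (\<Sum>s<S. w $ s) * Yb $$ (i, j)"
      by (simp add: right_diff_distrib sum_subtractf sum_distrib_right)
    then show "D w $$ (i, j) = (P w - Yb) $$ (i, j)"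
      using ij Yb that by (simp add: D_def P_def prob_simplex_def)
  qed (use Yb in \<open>auto simp: D_def mat_lincomb_def\<close>)
  have gradient: "gw_gradient \<beta> S w (net_class Y) = P w - Yb" for w
    using Yb by (intro eq_matI) (auto simp: gw_gradient_def rule_Y P_def n_def)
  have vanishes: "gw_gradient_vanishes \<beta> S w (net_class Y) \<longleftrightarrow> P w - Yb = 0\<^sub>m n n" for w
    by (simp add: gw_gradient_vanishes_def gradient rule_Y n_def)
  have Q_0: "?Q w = 0 \<longleftrightarrow> gw_gradient_vanishes \<beta> S w (net_class Y)"
    if "w \<in> prob_simplex S" for w
  proof -
    have "D w \<in> carrier_mat (dim_vec qb) (dim_vec qb)"
      by (simp add: D_def n_def)
    then show ?thesis
      unfolding Q[OF that] vanishes D_eq[OF that, symmetric] n_def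
      using wtrace_self_eq_0_iff[of qb "D w", OF q_pos] by blast
  qed
  have bary: "net_class Y \<in> weak_bary \<beta> S \<longleftrightarrow> (\<exists>w\<in>prob_simplex S. ?Q w = 0)"
    using network by (auto simp: weak_bary_def net_classes_def net_class_def Q_0 intro: quotientI)
  \<comment> \<open>Zero is a lower bound of \<open>?Q\<close> on the simplex, so a zero is a
    minimizer without any compactness argument.\<close>
  have argmin_0: "?argmin w" if "w \<in> prob_simplex S" "?Q w = 0" for w
    using that Q_nonneg by (auto simp: is_arg_min_def not_less)
  have argmin_iff: "?argmin w \<longleftrightarrow> w \<in> prob_simplex S \<and> ?Q w = 0"
    if bary_Y: "net_class Y \<in> weak_bary \<beta> S" for w
  proof
    assume w: "?argmin w"
    from bary_Y obtain v where "v \<in> prob_simplex S" "?Q v = 0"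
      using bary by blast
    with w Q_nonneg[of w] show "w \<in> prob_simplex S \<and> ?Q w = 0"
      unfolding is_arg_min_def by force
  qed (use argmin_0 in blast)
  have P_eq_iff: "?Q w = 0 \<longleftrightarrow> P w = Yb" if "w \<in> prob_simplex S" for w
  proof -
    have "P w - Yb = 0\<^sub>m n n \<longleftrightarrow> P w = Yb"
    proof
      assume 0: "P w - Yb = 0\<^sub>m n n"
      have "P w $$ (i, j) = Yb $$ (i, j)" if "i < n" "j < n" for i j
        using arg_cong[OF 0, of "\<lambda>M. M $$ (i, j)"] that Yb by simp
      then show "P w = Yb"
        using Yb by (intro eq_matI) (auto simp: P_def mat_lincomb_def)
    qed (use Yb in simp)
    then show ?thesis
      using Q_0[OF that] vanishes by simp
  qed
  have L_vec: "L *\<^sub>v w = vec S (\<lambda>s. wtrace qb (Xb ! s) (P w))" if "w \<in> carrier_vec S" for w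
    unfolding L_def P_def n_def using gram_mult_vec[OF that] by (intro eq_vecI) auto
  \<comment> \<open>With \<open>Yb\<close> in the second slot, \<open>L *\<^sub>v w = c\<close>
    follows from \<open>P w = Yb\<close> by substitution.\<close>
  have c: "c = vec S (\<lambda>s. wtrace qb (Xb ! s) Yb)"
    by (simp add: c_def wtrace_commute)
  \<comment> \<open>The linear system is the normal equation: the residual \<open>P w - Yb\<close>
    is orthogonal to every template. The zero \<open>v\<close> places \<open>Yb\<close> in the span
    of the templates, which forces the residual to vanish.\<close>
  have linear: "?Q w = 0 \<longleftrightarrow> L *\<^sub>v w = c"
    if w: "w \<in> prob_simplex S" and v: "v \<in> prob_simplex S" "?Q v = 0" for w v
  proof
    assume "?Q w = 0"
    then show "L *\<^sub>v w = c"
      by (simp add: L_vec c carrier[OF w] P_eq_iff[OF w])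
  next
    assume "L *\<^sub>v w = c"
    moreover have "L *\<^sub>v v = c"
      using v by (simp add: L_vec c carrier P_eq_iff)
    moreover have LS: "L \<in> carrier_mat S S"
      by (simp add: L_def)
    ultimately have "L *\<^sub>v (w - v) = 0\<^sub>v S"
      using carrier[OF w] carrier[OF v(1)]
      by (simp add: mult_minus_distrib_mat_vec c_def)
    \<comment> \<open>The vector \<open>w - v\<close> has left the simplex, but the Gram identity
      holds for every vector of dimension \<open>S\<close>; its quadratic form under
      \<open>L\<close> is zero.\<close>
    then have "wtrace qb (P (w - v)) (P (w - v)) = 0"
      using gram_quadratic_form[of "w - v" S qb "(!) Xb"] carrier[OF w] carrier[OF v(1)]
      by (simp add: L_def P_def n_def)
    then have 0: "P (w - v) = 0\<^sub>m n n"
      using wtrace_self_eq_0_iff[of qb "P (w - v)", OF q_pos] by (simp add: P_def n_def)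
    have "P w = P v"
    proof (rule eq_matI)
      fix i j assume ij: "i < dim_row (P v)" "j < dim_col (P v)"
      then have ij': "i < n" "j < n"
        by (auto simp: P_def mat_lincomb_def)
      \<comment> \<open>\<open>P\<close> is linear in the weights, so \<open>P (w - v)\<close>
        vanishing entrywise identifies \<open>P w\<close> with \<open>P v\<close>, which is
        \<open>Yb\<close>.\<close>
      have "(\<Sum>s<S. (w - v) $ s * Xb ! s $$ (i, j)) = 0"
        using arg_cong[OF 0, of "\<lambda>M. M $$ (i, j)"] ij' by (simp add: P_def)
      then show "P w $$ (i, j) = P v $$ (i, j)"
        using ij' carrier[OF w] carrier[OF v(1)]
        by (simp add: P_def left_diff_distrib sum_subtractf)
    qed (auto simp: P_def mat_lincomb_def)
    then show "?Q w = 0"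
      using v w by (simp add: P_eq_iff)
  qed
  show ?thesis
  proof (intro conjI impI allI)
    show "net_class Y \<in> weak_bary \<beta> S \<longleftrightarrow> (\<exists>w. ?argmin w \<and> ?Q w = 0)"
      using bary argmin_0 unfolding is_arg_min_def by blast
  next
    fix w assume "net_class Y \<in> weak_bary \<beta> S" "?argmin w"
    then show "gw_gradient_vanishes \<beta> S w (net_class Y)"
      using argmin_iff Q_0 by blast
  next
    fix w assume "net_class Y \<in> weak_bary \<beta> S"
    \<comment> \<open>Membership in the barycenter space supplies, through \<open>bary\<close>, the
      zero \<open>v\<close> that \<open>linear\<close> asks for.\<close>
    then show "?argmin w \<longleftrightarrow> w \<in> prob_simplex S \<and> L *\<^sub>v w = c"
      using argmin_iff bary linear by blast
  qed
qed

end
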